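(* Let $\mathbf{V}$ be a variety of algebras and let $m<n$ be positive integers such that the free $\mathbf{V}$-algebra $F_{\mathbf{V}}(x_1,\dots,x_m)$ on $m$ generators has a subalgebra free in $\mathbf{V}$ on $n$ generators, and such that $\mathbf{V}$ is generated as a variety by $F_{\mathbf{V}}(x_1,\dots,x_m)$. Then for every natural number $N$, $F_{\mathbf{V}}(x_1,\dots,x_m)$ has a subalgebra free in $\mathbf{V}$ on $N$ generators.
   Context: Algebras may have operations of infinite arity; the empty algebra is admitted when there are no zeroary operations. A variety is the class of all algebras of a given type satisfying a given class of identities. The variety generated by an algebra is the least variety containing it, i.e. the class of all algebras of that type satisfying every identity that holds in that algebra. *)

theory Defs
  imports "HOL-Library.FuncSet"
begin

(* The operation symbols of a type form an arbitrary (possibly empty) set, and the arity of a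
   symbol is an arbitrary (possibly empty or infinite) set of argument positions. *)
record ('f, 'i) signature =
  ops :: "'f set"
  arity :: "'f \<Rightarrow> 'i set"

record ('f, 'i, 'a) algebra =
  carrier :: "'a set"
  oper :: "'f \<Rightarrow> ('i \<Rightarrow> 'a) \<Rightarrow> 'a"

(* The carrier may be empty, provided that no symbol has empty arity. *)
definition algebra :: "('f, 'i) signature \<Rightarrow> ('f, 'i, 'a) algebra \<Rightarrow> bool" where
  "algebra \<sigma> A \<longleftrightarrow>
    (\<forall>f\<in>ops \<sigma>. oper A f \<in> (arity \<sigma> f \<rightarrow>\<^sub>E carrier A) \<rightarrow> carrier A)"

definition subuniverse :: "('f, 'i) signature \<Rightarrow> ('f, 'i, 'a) algebra \<Rightarrow> 'a set \<Rightarrow> bool" where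
  "subuniverse \<sigma> A S \<longleftrightarrow>
    S \<subseteq> carrier A \<and> (\<forall>f\<in>ops \<sigma>. oper A f \<in> (arity \<sigma> f \<rightarrow>\<^sub>E S) \<rightarrow> S)"

abbreviation subalg :: "('f, 'i, 'a) algebra \<Rightarrow> 'a set \<Rightarrow> ('f, 'i, 'a) algebra" where
  "subalg A S \<equiv> A\<lparr>carrier := S\<rparr>"

definition hom ::
  "('f, 'i) signature \<Rightarrow> ('f, 'i, 'a) algebra \<Rightarrow> ('f, 'i, 'b) algebra \<Rightarrow> ('a \<Rightarrow> 'b) set" where
  "hom \<sigma> A B = {h \<in> carrier A \<rightarrow>\<^sub>E carrier B.
    \<forall>f\<in>ops \<sigma>. \<forall>a\<in>arity \<sigma> f \<rightarrow>\<^sub>E carrier A.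
      h (oper A f a) = oper B f (\<lambda>i\<in>arity \<sigma> f. h (a i))}"

(* In Op f ts only the subterms at the positions in the arity of f are significant. *)
datatype (dead 'f, dead 'i, 'v) trm = Var 'v | Op 'f "'i \<Rightarrow> ('f, 'i, 'v) trm"

inductive_set terms :: "('f, 'i) signature \<Rightarrow> 'v set \<Rightarrow> ('f, 'i, 'v) trm set"
  for \<sigma> :: "('f, 'i) signature" and X :: "'v set" where
  "x \<in> X \<Longrightarrow> Var x \<in> terms \<sigma> X"
| "f \<in> ops \<sigma> \<Longrightarrow> (\<And>i. i \<in> arity \<sigma> f \<Longrightarrow> ts i \<in> terms \<sigma> X) \<Longrightarrow> Op f ts \<in> terms \<sigma> X"

primrec eval ::
  "('f, 'i) signature \<Rightarrow> ('f, 'i, 'a) algebra \<Rightarrow> ('v \<Rightarrow> 'a) \<Rightarrow> ('f, 'i, 'v) trm \<Rightarrow> 'a" where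
  "eval \<sigma> A v (Var x) = v x"
| "eval \<sigma> A v (Op f ts) = oper A f (\<lambda>i\<in>arity \<sigma> f. eval \<sigma> A v (ts i))"

definition satisfies ::
  "('f, 'i) signature \<Rightarrow> ('f, 'i, 'a) algebra \<Rightarrow> ('f, 'i, 'v) trm \<times> ('f, 'i, 'v) trm \<Rightarrow> bool" where
  "satisfies \<sigma> A e \<longleftrightarrow>
    (\<forall>v\<in>UNIV \<rightarrow> carrier A. eval \<sigma> A v (fst e) = eval \<sigma> A v (snd e))"

(* Terms may involve infinitely many variables. A term has at most as many variables as there
   are finite sequences of positions, so this type has enough variables to express every
   identity: see inj_on_vars and satisfies_rename below. *)
type_synonym 'i var = "nat + 'i"

type_synonym ('f, 'i) identity = "('f, 'i, 'i var) trm \<times> ('f, 'i, 'i var) trm"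

definition identities :: "('f, 'i) signature \<Rightarrow> ('f, 'i) identity set" where
  "identities \<sigma> = terms \<sigma> UNIV \<times> terms \<sigma> UNIV"

(* The class of algebras is given at every carrier type 'a by its set of defining identities. *)
definition variety ::
  "('f, 'i) signature \<Rightarrow> ('f, 'i) identity set \<Rightarrow> ('f, 'i, 'a) algebra set" where
  "variety \<sigma> E = {A. algebra \<sigma> A \<and> (\<forall>e\<in>E. satisfies \<sigma> A e)}"

definition identities_of ::
  "('f, 'i) signature \<Rightarrow> ('f, 'i, 'a) algebra \<Rightarrow> ('f, 'i) identity set" where
  "identities_of \<sigma> A = {e \<in> identities \<sigma>. satisfies \<sigma> A e}"

(* The variety defined by E is the one generated by A. A formula can compare two classes of
   algebras at one carrier type only; the type of terms is large enough for equality there to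
   imply equality at every carrier type (generated_by_all_types). *)
definition generated_by ::
  "('f, 'i) signature \<Rightarrow> ('f, 'i) identity set \<Rightarrow> ('f, 'i, 'a) algebra \<Rightarrow> bool" where
  "generated_by \<sigma> E A \<longleftrightarrow>
    (variety \<sigma> E :: ('f, 'i, ('f, 'i, 'i var) trm) algebra set) = variety \<sigma> (identities_of \<sigma> A)"

(* A is free in the variety on the family (x k) for k in K, by the universal property. The test
   algebras B have carriers in a type that contains a copy of A and of every algebra generated
   by a K-indexed family; the property at every other carrier type follows (free_on_all_types).
   The family x need not be injective, which matters only in a trivial variety. *)
definition free_on ::
  "('f, 'i) signature \<Rightarrow> ('f, 'i) identity set \<Rightarrow> ('f, 'i, 'a) algebra \<Rightarrow> 'k set \<Rightarrow> ('k \<Rightarrow> 'a) \<Rightarrow> bool"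
  where
  "free_on \<sigma> E A K x \<longleftrightarrow> A \<in> variety \<sigma> E \<and> x \<in> K \<rightarrow> carrier A \<and>
    (\<forall>B :: ('f, 'i, 'a + ('f, 'i, 'k) trm) algebra. B \<in> variety \<sigma> E \<longrightarrow>
      (\<forall>y\<in>K \<rightarrow> carrier B. \<exists>!h. h \<in> hom \<sigma> A B \<and> (\<forall>k\<in>K. h (x k) = y k)))"

definition free_on_generators ::
  "('f, 'i) signature \<Rightarrow> ('f, 'i) identity set \<Rightarrow> ('f, 'i, 'a) algebra \<Rightarrow> nat \<Rightarrow> bool" where
  "free_on_generators \<sigma> E A n \<longleftrightarrow> (\<exists>x :: nat \<Rightarrow> 'a. free_on \<sigma> E A {..<n} x)"


subsection \<open>Every identity can be written in the variables chosen above\<close>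

primrec vars :: "('f, 'i) signature \<Rightarrow> ('f, 'i, 'v) trm \<Rightarrow> 'v set" where
  "vars \<sigma> (Var x) = {x}"
| "vars \<sigma> (Op f ts) = (\<Union>i\<in>arity \<sigma> f. vars \<sigma> (ts i))"

lemma card_of_vars:
  fixes t :: "('f, 'i, 'v) trm"
  shows "(card_of (vars \<sigma> t), card_of (UNIV :: 'i var set)) \<in> ordLeq"
proof (induction t)
  case (Var x)
  show ?case
    by (metis vars.simps(1) card_of_singl_ordLeq UNIV_not_empty)
next
  case (Op f ts)
  have inf: "infinite (UNIV :: 'i var set)"
    by simp
  have "inj_on Inr (arity \<sigma> f)" "Inr ` arity \<sigma> f \<subseteq> (UNIV :: 'i var set)"
    by auto
  then have "(card_of (arity \<sigma> f), card_of (UNIV :: 'i var set)) \<in> ordLeq"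
    using card_of_ordLeq by blast
  with inf Op show ?case
    by (auto intro!: card_of_UNION_ordLeq_infinite)
qed

lemma inj_on_vars:
  fixes s t :: "('f, 'i, 'v) trm"
  shows "\<exists>g :: 'v \<Rightarrow> 'i var. inj_on g (vars \<sigma> s \<union> vars \<sigma> t)"
proof -
  have "infinite (UNIV :: 'i var set)"
    by simp
  then have "(card_of (vars \<sigma> s \<union> vars \<sigma> t), card_of (UNIV :: 'i var set)) \<in> ordLeq"
    using card_of_vars
    by (intro card_of_Un_ordLeq_infinite_Field card_of_Card_order) (simp_all add: Field_card_of)
  then show ?thesis
    unfolding card_of_ordLeq[symmetric] by simp
qed

lemma eval_cong_vars:
  "(\<And>x. x \<in> vars \<sigma> t \<Longrightarrow> v x = w x) \<Longrightarrow> eval \<sigma> A v t = eval \<sigma> A w t"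
proof (induction t)
  case (Op f ts)
  then have "(\<lambda>i\<in>arity \<sigma> f. eval \<sigma> A v (ts i)) = (\<lambda>i\<in>arity \<sigma> f. eval \<sigma> A w (ts i))"
    by (intro restrict_ext) auto
  then show ?case
    by simp
qed simp

lemma eval_map_trm: "eval \<sigma> A v (map_trm g t) = eval \<sigma> A (v \<circ> g) t"
  by (induction t) (auto intro!: arg_cong[of _ _ "oper A _"] restrict_ext)

lemma map_trm_terms: "t \<in> terms \<sigma> X \<Longrightarrow> map_trm g t \<in> terms \<sigma> (g ` X)"
  by (induction rule: terms.induct) (auto intro: terms.intros)

lemma satisfies_rename:
  fixes A :: "('f, 'i, 'a) algebra" and s t :: "('f, 'i, 'v) trm" and g :: "'v \<Rightarrow> 'w"
  assumes g: "inj_on g (vars \<sigma> s \<union> vars \<sigma> t)"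
  shows "satisfies \<sigma> A (map_trm g s, map_trm g t) \<longleftrightarrow> satisfies \<sigma> A (s, t)"
proof
  assume L: "satisfies \<sigma> A (map_trm g s, map_trm g t)"
  show "satisfies \<sigma> A (s, t)"
    unfolding satisfies_def
  proof (intro ballI)
    fix v :: "'v \<Rightarrow> 'a" assume v: "v \<in> UNIV \<rightarrow> carrier A"
    define w where "w = v \<circ> inv_into (vars \<sigma> s \<union> vars \<sigma> t) g"
    have w: "w \<in> UNIV \<rightarrow> carrier A"
      using v by (auto simp: w_def)
    have eq: "(w \<circ> g) x = v x" if "x \<in> vars \<sigma> s \<union> vars \<sigma> t" for x
      using that g by (simp add: w_def inv_into_f_f)
    have "eval \<sigma> A (w \<circ> g) s = eval \<sigma> A (w \<circ> g) t"
      using L w by (simp add: satisfies_def eval_map_trm)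
    moreover have "eval \<sigma> A (w \<circ> g) s = eval \<sigma> A v s" "eval \<sigma> A (w \<circ> g) t = eval \<sigma> A v t"
      using eq by (blast intro: eval_cong_vars)+
    ultimately show "eval \<sigma> A v (fst (s, t)) = eval \<sigma> A v (snd (s, t))"
      by simp
  qed
next
  assume R: "satisfies \<sigma> A (s, t)"
  then show "satisfies \<sigma> A (map_trm g s, map_trm g t)"
    by (auto simp: satisfies_def eval_map_trm Pi_iff)
qed


subsection \<open>The definitions do not depend on the carrier types at which they quantify\<close>

lemma oper_in_carrier:
  "algebra \<sigma> A \<Longrightarrow> f \<in> ops \<sigma> \<Longrightarrow> a \<in> arity \<sigma> f \<rightarrow>\<^sub>E carrier A \<Longrightarrow> oper A f a \<in> carrier A"
  unfolding algebra_def by blast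

lemma oper_in_subuniverse:
  "subuniverse \<sigma> A S \<Longrightarrow> f \<in> ops \<sigma> \<Longrightarrow> a \<in> arity \<sigma> f \<rightarrow>\<^sub>E S \<Longrightarrow> oper A f a \<in> S"
  unfolding subuniverse_def by blast

lemma eval_in_carrier:
  assumes "algebra \<sigma> A" "v \<in> X \<rightarrow> carrier A" "t \<in> terms \<sigma> X"
  shows "eval \<sigma> A v t \<in> carrier A"
  using assms(3)
proof (induction rule: terms.induct)
  case (2 f ts)
  then have "(\<lambda>i\<in>arity \<sigma> f. eval \<sigma> A v (ts i)) \<in> arity \<sigma> f \<rightarrow>\<^sub>E carrier A"
    by auto
  with 2(1) show ?case
    by (simp add: oper_in_carrier[OF assms(1)])
qed (use assms(2) in auto)

lemma hom_mem: "h \<in> hom \<sigma> A B \<Longrightarrow> a \<in> carrier A \<Longrightarrow> h a \<in> carrier B"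
  by (auto simp: hom_def)

lemma hom_eval:
  assumes "h \<in> hom \<sigma> A B" "algebra \<sigma> A" "v \<in> X \<rightarrow> carrier A" "t \<in> terms \<sigma> X"
  shows "h (eval \<sigma> A v t) = eval \<sigma> B (h \<circ> v) t"
  using assms(4)
proof (induction rule: terms.induct)
  case (2 f ts)
  have "(\<lambda>i\<in>arity \<sigma> f. eval \<sigma> A v (ts i)) \<in> arity \<sigma> f \<rightarrow>\<^sub>E carrier A"
    using eval_in_carrier[OF assms(2,3)] 2 by auto
  then have "h (oper A f (\<lambda>i\<in>arity \<sigma> f. eval \<sigma> A v (ts i))) =
      oper B f (\<lambda>i\<in>arity \<sigma> f. h ((\<lambda>i\<in>arity \<sigma> f. eval \<sigma> A v (ts i)) i))"
    using assms(1) 2 by (simp add: hom_def)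
  also have "(\<lambda>i\<in>arity \<sigma> f. h ((\<lambda>i\<in>arity \<sigma> f. eval \<sigma> A v (ts i)) i)) =
      (\<lambda>i\<in>arity \<sigma> f. eval \<sigma> B (h \<circ> v) (ts i))"
    using 2 by (intro restrict_ext) (simp add: comp_def)
  finally show ?case
    unfolding eval.simps .
qed simp

lemma hom_compose:
  assumes A: "algebra \<sigma> A" and h: "h \<in> hom \<sigma> A B" and g: "g \<in> hom \<sigma> B C"
  shows "compose (carrier A) g h \<in> hom \<sigma> A C"
  unfolding hom_def mem_Collect_eq
proof (intro conjI ballI)
  show "compose (carrier A) g h \<in> carrier A \<rightarrow>\<^sub>E carrier C"
    using h g by (auto simp: hom_def compose_def)
  fix f a assume f: "f \<in> ops \<sigma>" and a: "a \<in> arity \<sigma> f \<rightarrow>\<^sub>E carrier A"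
  have ha: "(\<lambda>i\<in>arity \<sigma> f. h (a i)) \<in> arity \<sigma> f \<rightarrow>\<^sub>E carrier B"
    using h a by (auto simp: hom_def)
  have ch: "(\<lambda>i\<in>arity \<sigma> f. compose (carrier A) g h (a i)) =
      (\<lambda>i\<in>arity \<sigma> f. g ((\<lambda>i\<in>arity \<sigma> f. h (a i)) i))"
    using a by (intro restrict_ext) (auto simp: compose_def)
  have gh: "g (h (oper A f a)) = oper C f (\<lambda>i\<in>arity \<sigma> f. g ((\<lambda>i\<in>arity \<sigma> f. h (a i)) i))"
    using h g f a ha by (simp add: hom_def)
  have "oper A f a \<in> carrier A"
    by (rule oper_in_carrier[OF A f a])
  then show "compose (carrier A) g h (oper A f a) =
      oper C f (\<lambda>i\<in>arity \<sigma> f. compose (carrier A) g h (a i))"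
    using ch gh by (simp add: compose_def)
qed

lemma satisfies_inj_hom:
  fixes B :: "('f, 'i, 'b) algebra" and C :: "('f, 'i, 'c) algebra"
  assumes B: "algebra \<sigma> B" and h: "h \<in> hom \<sigma> B C" "inj_on h (carrier B)"
    and e: "e \<in> identities \<sigma>" "satisfies \<sigma> C e"
  shows "satisfies \<sigma> B e"
  unfolding satisfies_def
proof (intro ballI)
  fix v :: "'i var \<Rightarrow> 'b" assume v: "v \<in> UNIV \<rightarrow> carrier B"
  have st: "fst e \<in> terms \<sigma> UNIV" "snd e \<in> terms \<sigma> UNIV"
    using e(1) by (auto simp: identities_def)
  have "h \<circ> v \<in> UNIV \<rightarrow> carrier C"
    using v hom_mem[OF h(1)] by (auto simp: Pi_iff)
  then have "h (eval \<sigma> B v (fst e)) = h (eval \<sigma> B v (snd e))"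
    using e(2) hom_eval[OF h(1) B v] st by (auto simp: satisfies_def)
  then show "eval \<sigma> B v (fst e) = eval \<sigma> B v (snd e)"
    using h(2) eval_in_carrier[OF B v] st by (auto dest: inj_onD)
qed

lemma variety_inj_hom:
  assumes "E \<subseteq> identities \<sigma>" "algebra \<sigma> B" "h \<in> hom \<sigma> B C" "inj_on h (carrier B)"
    "C \<in> variety \<sigma> E"
  shows "B \<in> variety \<sigma> E"
  using assms satisfies_inj_hom by (fastforce simp: variety_def)

lemma subuniverse_eval:
  assumes A: "algebra \<sigma> A" and v: "v \<in> X \<rightarrow> carrier A"
  shows "subuniverse \<sigma> A (eval \<sigma> A v ` terms \<sigma> X)"
  unfolding subuniverse_def
proof (intro conjI ballI funcsetI)
  show "eval \<sigma> A v ` terms \<sigma> X \<subseteq> carrier A"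
    using eval_in_carrier[OF A v] by auto
  fix f a assume f: "f \<in> ops \<sigma>" and a: "a \<in> arity \<sigma> f \<rightarrow>\<^sub>E eval \<sigma> A v ` terms \<sigma> X"
  then have "\<forall>i\<in>arity \<sigma> f. \<exists>t. t \<in> terms \<sigma> X \<and> a i = eval \<sigma> A v t"
    by (auto simp: PiE_iff)
  then obtain ts where ts: "\<And>i. i \<in> arity \<sigma> f \<Longrightarrow> ts i \<in> terms \<sigma> X \<and> a i = eval \<sigma> A v (ts i)"
    by metis
  have "a = (\<lambda>i\<in>arity \<sigma> f. eval \<sigma> A v (ts i))"
    using a ts by (intro extensionalityI[where A = "arity \<sigma> f"]) (auto simp: PiE_iff)
  then have "oper A f a = eval \<sigma> A v (Op f ts)"
    by simp
  moreover have "Op f ts \<in> terms \<sigma> X"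
    using f ts by (auto intro: terms.intros)
  ultimately show "oper A f a \<in> eval \<sigma> A v ` terms \<sigma> X"
    by blast
qed

definition copy ::
  "('f, 'i) signature \<Rightarrow> ('f, 'i, 'a) algebra \<Rightarrow> 'a set \<Rightarrow> ('a \<Rightarrow> 'b) \<Rightarrow> ('f, 'i, 'b) algebra" where
  "copy \<sigma> A S r = \<lparr>carrier = r ` S,
    oper = (\<lambda>f b. r (oper A f (\<lambda>i\<in>arity \<sigma> f. inv_into S r (b i))))\<rparr>"

lemma copy:
  assumes S: "subuniverse \<sigma> A S" and r: "inj_on r S"
  shows carrier_copy: "carrier (copy \<sigma> A S r) = r ` S"
    and algebra_copy: "algebra \<sigma> (copy \<sigma> A S r)"
    and hom_to_copy: "restrict r S \<in> hom \<sigma> (subalg A S) (copy \<sigma> A S r)"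
    and hom_from_copy: "restrict (inv_into S r) (r ` S) \<in> hom \<sigma> (copy \<sigma> A S r) A"
proof -
  show "carrier (copy \<sigma> A S r) = r ` S"
    by (simp add: copy_def)
  have in_S: "oper A f (\<lambda>i\<in>arity \<sigma> f. inv_into S r (b i)) \<in> S"
    if "f \<in> ops \<sigma>" "b \<in> arity \<sigma> f \<rightarrow>\<^sub>E r ` S" for f b
  proof -
    have "(\<lambda>i\<in>arity \<sigma> f. inv_into S r (b i)) \<in> arity \<sigma> f \<rightarrow>\<^sub>E S"
      using that(2) by (auto simp: PiE_iff intro: inv_into_into)
    then show ?thesis
      by (rule oper_in_subuniverse[OF S that(1)])
  qed
  then show "algebra \<sigma> (copy \<sigma> A S r)"
    by (auto simp: algebra_def copy_def)
  show "restrict (inv_into S r) (r ` S) \<in> hom \<sigma> (copy \<sigma> A S r) A"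
    unfolding hom_def mem_Collect_eq
  proof (intro conjI ballI)
    show "restrict (inv_into S r) (r ` S) \<in> carrier (copy \<sigma> A S r) \<rightarrow>\<^sub>E carrier A"
      using S r by (auto simp: copy_def subuniverse_def)
    fix f b assume f: "f \<in> ops \<sigma>" and "b \<in> arity \<sigma> f \<rightarrow>\<^sub>E carrier (copy \<sigma> A S r)"
    then have b: "b \<in> arity \<sigma> f \<rightarrow>\<^sub>E r ` S"
      by (simp add: copy_def)
    have "(\<lambda>i\<in>arity \<sigma> f. restrict (inv_into S r) (r ` S) (b i)) =
        (\<lambda>i\<in>arity \<sigma> f. inv_into S r (b i))"
      using b by (intro restrict_ext) (auto simp: PiE_iff)
    then show "restrict (inv_into S r) (r ` S) (oper (copy \<sigma> A S r) f b) =
        oper A f (\<lambda>i\<in>arity \<sigma> f. restrict (inv_into S r) (r ` S) (b i))"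
      using in_S[OF f b] r by (simp add: copy_def)
  qed
  show "restrict r S \<in> hom \<sigma> (subalg A S) (copy \<sigma> A S r)"
    unfolding hom_def mem_Collect_eq
  proof (intro conjI ballI)
    show "restrict r S \<in> carrier (subalg A S) \<rightarrow>\<^sub>E carrier (copy \<sigma> A S r)"
      by (auto simp: copy_def)
    fix f a assume f: "f \<in> ops \<sigma>" and "a \<in> arity \<sigma> f \<rightarrow>\<^sub>E carrier (subalg A S)"
    then have a: "a \<in> arity \<sigma> f \<rightarrow>\<^sub>E S"
      by simp
    have "oper A f a \<in> S"
      by (rule oper_in_subuniverse[OF S f a])
    moreover have "(\<lambda>i\<in>arity \<sigma> f. inv_into S r ((\<lambda>i\<in>arity \<sigma> f. restrict r S (a i)) i)) = a"
      using a r by (intro extensionalityI[where A = "arity \<sigma> f"]) (auto simp: PiE_iff)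
    ultimately show "restrict r S (oper (subalg A S) f a) =
        oper (copy \<sigma> A S r) f (\<lambda>i\<in>arity \<sigma> f. restrict r S (a i))"
      by (simp add: copy_def)
  qed
qed

lemma copy_in_variety:
  assumes "E \<subseteq> identities \<sigma>" "A \<in> variety \<sigma> E" "subuniverse \<sigma> A S" "inj_on r S"
  shows "copy \<sigma> A S r \<in> variety \<sigma> E"
proof (rule variety_inj_hom)
  show "inj_on (restrict (inv_into S r) (r ` S)) (carrier (copy \<sigma> A S r))"
    using inj_on_inv_into[of "r ` S" r S] assms(3,4)
    by (simp add: carrier_copy inj_on_def)
qed (use assms algebra_copy hom_from_copy in auto)

lemma variety_mono_all_types:
  fixes A :: "('f, 'i, 'a) algebra"
  assumes E: "E1 \<subseteq> identities \<sigma>" "E2 \<subseteq> identities \<sigma>"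
    and sub: "(variety \<sigma> E1 :: ('f, 'i, ('f, 'i, 'i var) trm) algebra set) \<subseteq> variety \<sigma> E2"
    and A: "A \<in> variety \<sigma> E1"
  shows "A \<in> variety \<sigma> E2"
proof -
  have alg: "algebra \<sigma> A"
    using A by (simp add: variety_def)
  moreover have "satisfies \<sigma> A e" if e: "e \<in> E2" for e
    unfolding satisfies_def
  proof (intro ballI)
    fix v :: "'i var \<Rightarrow> 'a" assume v: "v \<in> UNIV \<rightarrow> carrier A"
    define S where "S = eval \<sigma> A v ` terms \<sigma> UNIV"
    define r where "r = inv_into (terms \<sigma> UNIV) (eval \<sigma> A v)"
    define j where "j = restrict (inv_into S r) (r ` S)"
    have S: "subuniverse \<sigma> A S"
      unfolding S_def by (rule subuniverse_eval[OF alg v])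
    have r: "inj_on r S"
      by (simp add: S_def r_def inj_on_inv_into)
    have P: "copy \<sigma> A S r \<in> variety \<sigma> E2"
      using copy_in_variety[OF E(1) A S r] sub by blast
    have j: "j \<in> hom \<sigma> (copy \<sigma> A S r) A"
      unfolding j_def by (rule hom_from_copy[OF S r])
    have vS: "v x \<in> S" for x
      unfolding S_def by (rule image_eqI[of _ _ "Var x"]) (auto intro: terms.intros)
    then have w: "r \<circ> v \<in> UNIV \<rightarrow> carrier (copy \<sigma> A S r)"
      by (auto simp: carrier_copy[OF S r])
    have jw: "j \<circ> (r \<circ> v) = v"
      using vS r by (auto simp: j_def)
    have st: "fst e \<in> terms \<sigma> UNIV" "snd e \<in> terms \<sigma> UNIV"
      using e E(2) by (auto simp: identities_def)
    have "eval \<sigma> (copy \<sigma> A S r) (r \<circ> v) (fst e) = eval \<sigma> (copy \<sigma> A S r) (r \<circ> v) (snd e)"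
      using P e w by (auto simp: variety_def satisfies_def)
    then show "eval \<sigma> A v (fst e) = eval \<sigma> A v (snd e)"
      using hom_eval[OF j algebra_copy[OF S r] w st(1)] hom_eval[OF j algebra_copy[OF S r] w st(2)]
      by (simp add: jw)
  qed
  ultimately show ?thesis
    by (simp add: variety_def)
qed

lemma generated_by_all_types:
  assumes "E \<subseteq> identities \<sigma>" "generated_by \<sigma> E A"
  shows "(variety \<sigma> E :: ('f, 'i, 'c) algebra set) = variety \<sigma> (identities_of \<sigma> A)"
proof -
  have I: "identities_of \<sigma> A \<subseteq> identities \<sigma>"
    by (auto simp: identities_of_def)
  show ?thesis
    using variety_mono_all_types[OF assms(1) I] variety_mono_all_types[OF I assms(1)] assms(2)
    unfolding generated_by_def by blast
qed

lemma generated_by_least: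
  fixes A :: "('f, 'i, 'a) algebra"
  assumes "E \<subseteq> identities \<sigma>" "algebra \<sigma> A"
  shows "generated_by \<sigma> E A \<longleftrightarrow> A \<in> variety \<sigma> E \<and>
    (\<forall>E'\<subseteq>identities \<sigma>. A \<in> variety \<sigma> E' \<longrightarrow>
      (variety \<sigma> E :: ('f, 'i, ('f, 'i, 'i var) trm) algebra set) \<subseteq> variety \<sigma> E')"
proof
  assume gen: "generated_by \<sigma> E A"
  have "A \<in> variety \<sigma> (identities_of \<sigma> A)"
    using assms(2) by (simp add: variety_def identities_of_def)
  then have "A \<in> variety \<sigma> E"
    using generated_by_all_types[OF assms(1) gen] by blast
  moreover have "(variety \<sigma> (identities_of \<sigma> A) ::
      ('f, 'i, ('f, 'i, 'i var) trm) algebra set) \<subseteq> variety \<sigma> E'"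
    if "E' \<subseteq> identities \<sigma>" "A \<in> variety \<sigma> E'" for E'
    using that by (auto simp: variety_def identities_of_def)
  ultimately show "A \<in> variety \<sigma> E \<and> (\<forall>E'\<subseteq>identities \<sigma>. A \<in> variety \<sigma> E' \<longrightarrow>
      (variety \<sigma> E :: ('f, 'i, ('f, 'i, 'i var) trm) algebra set) \<subseteq> variety \<sigma> E')"
    using gen unfolding generated_by_def by simp
next
  assume R: "A \<in> variety \<sigma> E \<and> (\<forall>E'\<subseteq>identities \<sigma>. A \<in> variety \<sigma> E' \<longrightarrow>
      (variety \<sigma> E :: ('f, 'i, ('f, 'i, 'i var) trm) algebra set) \<subseteq> variety \<sigma> E')"
  have "identities_of \<sigma> A \<subseteq> identities \<sigma>" "A \<in> variety \<sigma> (identities_of \<sigma> A)"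
    using assms(2) by (auto simp: variety_def identities_of_def)
  with R have "(variety \<sigma> E :: ('f, 'i, ('f, 'i, 'i var) trm) algebra set) \<subseteq>
      variety \<sigma> (identities_of \<sigma> A)"
    by blast
  moreover have "E \<subseteq> identities_of \<sigma> A"
    using R assms(1) by (auto simp: variety_def identities_of_def)
  then have "(variety \<sigma> (identities_of \<sigma> A) :: ('f, 'i, ('f, 'i, 'i var) trm) algebra set) \<subseteq>
      variety \<sigma> E"
    unfolding variety_def by blast
  ultimately show "generated_by \<sigma> E A"
    unfolding generated_by_def by (rule subset_antisym)
qed

lemma free_on_generates:
  fixes A :: "('f, 'i, 'a) algebra" and x :: "'k \<Rightarrow> 'a"
  assumes E: "E \<subseteq> identities \<sigma>" and free: "free_on \<sigma> E A K x"
  shows "carrier A = eval \<sigma> A x ` terms \<sigma> K"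
proof -
  have A: "A \<in> variety \<sigma> E" and x: "x \<in> K \<rightarrow> carrier A"
    using free by (auto simp: free_on_def)
  then have alg: "algebra \<sigma> A"
    by (simp add: variety_def)
  define S where "S = eval \<sigma> A x ` terms \<sigma> K"
  define r :: "'a \<Rightarrow> 'a + ('f, 'i, 'k) trm" where "r = Inl"
  have S: "subuniverse \<sigma> A S"
    unfolding S_def by (rule subuniverse_eval[OF alg x])
  have T: "subuniverse \<sigma> A (carrier A)"
    using alg by (auto simp: subuniverse_def algebra_def)
  have inj: "inj_on r X" for X
    by (simp add: r_def)
  define P where "P = copy \<sigma> A S r"
  define Q where "Q = copy \<sigma> A (carrier A) r"
  have xS: "x k \<in> S" if "k \<in> K" for k
    unfolding S_def using that by (intro image_eqI[of _ _ "Var k"]) (auto intro: terms.intros)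
  have P: "P \<in> variety \<sigma> E" and Q: "Q \<in> variety \<sigma> E"
    unfolding P_def Q_def using copy_in_variety[OF E A] S T inj by auto
  have "r \<circ> x \<in> K \<rightarrow> carrier P" "r \<circ> x \<in> K \<rightarrow> carrier Q"
    using x xS by (auto simp: P_def Q_def carrier_copy[OF S inj] carrier_copy[OF T inj] Pi_iff)
  then have exP: "\<exists>!h. h \<in> hom \<sigma> A P \<and> (\<forall>k\<in>K. h (x k) = (r \<circ> x) k)"
    and exQ: "\<exists>!h. h \<in> hom \<sigma> A Q \<and> (\<forall>k\<in>K. h (x k) = (r \<circ> x) k)"
    using free P Q unfolding free_on_def by blast+
  obtain h where h: "h \<in> hom \<sigma> A P" "\<And>k. k \<in> K \<Longrightarrow> h (x k) = r (x k)"
    using exP by auto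
  have inv: "inv_into X r (r a) = a" if "a \<in> X" for X a
    using that inj by simp
  have "h \<in> hom \<sigma> A Q"
    unfolding hom_def mem_Collect_eq
  proof (intro conjI ballI)
    show "h \<in> carrier A \<rightarrow>\<^sub>E carrier Q"
      using h(1) S unfolding hom_def P_def Q_def carrier_copy[OF S inj] carrier_copy[OF T inj]
      by (fastforce simp: subuniverse_def)
    fix f a assume f: "f \<in> ops \<sigma>" and a: "a \<in> arity \<sigma> f \<rightarrow>\<^sub>E carrier A"
    have "inv_into S r (h (a i)) = inv_into (carrier A) r (h (a i))" if "i \<in> arity \<sigma> f" for i
    proof -
      have "h (a i) \<in> r ` S"
        using hom_mem[OF h(1)] a that by (auto simp: P_def carrier_copy[OF S inj] PiE_iff)
      then show ?thesis
        using inv S by (auto simp: subuniverse_def)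
    qed
    then have "oper P f (\<lambda>i\<in>arity \<sigma> f. h (a i)) = oper Q f (\<lambda>i\<in>arity \<sigma> f. h (a i))"
      by (auto simp: P_def Q_def copy_def cong: restrict_cong)
    then show "h (oper A f a) = oper Q f (\<lambda>i\<in>arity \<sigma> f. h (a i))"
      using h(1) f a by (simp add: hom_def)
  qed
  moreover have "restrict r (carrier A) \<in> hom \<sigma> A Q"
    using hom_to_copy[OF T inj] by (simp add: Q_def)
  moreover have "restrict r (carrier A) (x k) = r (x k)" if "k \<in> K" for k
    using x that by auto
  ultimately have "h = restrict r (carrier A)"
    using h(2) exQ unfolding comp_apply by blast
  then have "r a \<in> r ` S" if "a \<in> carrier A" for a
    using hom_mem[OF h(1) that] that by (simp add: P_def carrier_copy[OF S inj])
  then have "carrier A \<subseteq> S"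
    by (auto simp: r_def)
  with S show ?thesis
    by (auto simp: S_def subuniverse_def)
qed

lemma free_on_all_types:
  fixes A :: "('f, 'i, 'a) algebra" and B :: "('f, 'i, 'b) algebra" and x :: "'k \<Rightarrow> 'a"
  assumes E: "E \<subseteq> identities \<sigma>" and free: "free_on \<sigma> E A K x"
    and B: "B \<in> variety \<sigma> E" and y: "y \<in> K \<rightarrow> carrier B"
  shows "\<exists>!h. h \<in> hom \<sigma> A B \<and> (\<forall>k\<in>K. h (x k) = y k)"
proof -
  have A: "algebra \<sigma> A" and x: "x \<in> K \<rightarrow> carrier A" and algB: "algebra \<sigma> B"
    using free B by (auto simp: free_on_def variety_def)
  define S where "S = eval \<sigma> B y ` terms \<sigma> K"
  define r :: "'b \<Rightarrow> 'a + ('f, 'i, 'k) trm" where "r = Inr \<circ> inv_into (terms \<sigma> K) (eval \<sigma> B y)"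
  define j where "j = restrict (inv_into S r) (r ` S)"
  have S: "subuniverse \<sigma> B S"
    unfolding S_def by (rule subuniverse_eval[OF algB y])
  have r: "inj_on r S"
    by (simp add: S_def r_def inj_on_inv_into comp_inj_on)
  have P: "copy \<sigma> B S r \<in> variety \<sigma> E"
    by (rule copy_in_variety[OF E B S r])
  have j: "j \<in> hom \<sigma> (copy \<sigma> B S r) B"
    unfolding j_def by (rule hom_from_copy[OF S r])
  have yS: "y k \<in> S" if "k \<in> K" for k
    unfolding S_def using that by (intro image_eqI[of _ _ "Var k"]) (auto intro: terms.intros)
  then have "r \<circ> y \<in> K \<rightarrow> carrier (copy \<sigma> B S r)"
    by (auto simp: carrier_copy[OF S r])
  then have "\<exists>!h. h \<in> hom \<sigma> A (copy \<sigma> B S r) \<and> (\<forall>k\<in>K. h (x k) = (r \<circ> y) k)"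
    using free P unfolding free_on_def by blast
  then obtain h where h: "h \<in> hom \<sigma> A (copy \<sigma> B S r)" "\<And>k. k \<in> K \<Longrightarrow> h (x k) = r (y k)"
    by auto
  have "compose (carrier A) j h \<in> hom \<sigma> A B"
    by (rule hom_compose[OF A h(1) j])
  moreover have "compose (carrier A) j h (x k) = y k" if "k \<in> K" for k
    using that h(2) x yS r by (auto simp: compose_def j_def Pi_iff)
  moreover have "g = g'"
    if g: "g \<in> hom \<sigma> A B" "g' \<in> hom \<sigma> A B" "\<And>k. k \<in> K \<Longrightarrow> g (x k) = g' (x k)" for g g'
  proof (rule extensionalityI)
    show "g \<in> extensional (carrier A)" "g' \<in> extensional (carrier A)"
      using g by (auto simp: hom_def PiE_def)
    fix a assume "a \<in> carrier A"
    then obtain t where t: "t \<in> terms \<sigma> K" "a = eval \<sigma> A x t"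
      using free_on_generates[OF E free] by blast
    have "eval \<sigma> B (g \<circ> x) t = eval \<sigma> B (g' \<circ> x) t"
      using t(1)
    proof (induction rule: terms.induct)
      case (2 f ts)
      then show ?case
        by (auto cong: restrict_cong)
    qed (use g(3) in auto)
    then show "g a = g' a"
      using t hom_eval[OF g(1) A x] hom_eval[OF g(2) A x] by simp
  qed
  ultimately show ?thesis
    by (intro ex1I[of _ "compose (carrier A) j h"]) auto
qed

end

(* Suppose F is free on x_0, ..., x_{m-1} and contains a free family u_0, ..., u_{n-1}, with m < n.
   Let \<theta> be the injective endomorphism x_i \<mapsto> u_i (i < m). Since u_m is independent of the range of
   \<theta>, the elements z_i = \<theta>^i (u_m) are free. Indeed, a relation s = t among z_0, ..., z_{N-1} stays
   valid when the z_i are replaced one after the other: pulling back along \<theta>^j, one may replace z_0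
   by anything while fixing z_1, z_2, ... and the values already substituted, provided these lie in
   the range of \<theta>. In the end s = t holds at \<theta>^N c_0, \<theta>^N c_1, ... for all c_i in F, hence at
   c_0, c_1, .... So it is an identity of F, and therefore of the variety that F generates. *)

theory Submission
  imports Defs
begin

section \<open>Evaluation and homomorphisms on subalgebras\<close>

lemma eval_subalg [simp]: "eval \<sigma> (subalg A S) v t = eval \<sigma> A v t"
  by (induction t) (auto cong: restrict_cong)

lemma eval_cong_terms:
  assumes "t \<in> terms \<sigma> X" "\<And>x. x \<in> X \<Longrightarrow> v x = w x"
  shows "eval \<sigma> A v t = eval \<sigma> A w t"
  using assms(1) by induction (auto simp: assms(2) cong: restrict_cong)

lemma algebra_subalg: "subuniverse \<sigma> A S \<Longrightarrow> algebra \<sigma> (subalg A S)"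
  by (auto simp: algebra_def subuniverse_def)

lemma hom_subalg_codomain:
  assumes "subuniverse \<sigma> B S" "h \<in> hom \<sigma> A (subalg B S)"
  shows "h \<in> hom \<sigma> A B"
  using assms by (fastforce simp: hom_def subuniverse_def)

lemma subalg_in_variety:
  assumes "E \<subseteq> identities \<sigma>" "A \<in> variety \<sigma> E" and S: "subuniverse \<sigma> A S"
  shows "subalg A S \<in> variety \<sigma> E"
proof (rule variety_inj_hom)
  show "restrict id S \<in> hom \<sigma> (subalg A S) A"
    unfolding hom_def mem_Collect_eq
  proof (intro conjI ballI)
    show "restrict id S \<in> carrier (subalg A S) \<rightarrow>\<^sub>E carrier A"
      using S by (auto simp: subuniverse_def)
    fix f a assume f: "f \<in> ops \<sigma>" and "a \<in> arity \<sigma> f \<rightarrow>\<^sub>E carrier (subalg A S)"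
    then have a: "a \<in> arity \<sigma> f \<rightarrow>\<^sub>E S"
      by simp
    moreover have "(\<lambda>i\<in>arity \<sigma> f. restrict id S (a i)) = a"
      using a by (intro extensionalityI[where A = "arity \<sigma> f"]) (auto simp: PiE_iff)
    ultimately show "restrict id S (oper (subalg A S) f a) =
        oper A f (\<lambda>i\<in>arity \<sigma> f. restrict id S (a i))"
      using oper_in_subuniverse[OF S f a] by simp
  qed
qed (use assms algebra_subalg in \<open>auto simp: inj_on_def\<close>)

lemma hom_eq_on_generated:
  assumes A: "algebra \<sigma> A" and v: "v \<in> X \<rightarrow> carrier A"
    and gen: "carrier A = eval \<sigma> A v ` terms \<sigma> X"
    and h: "h \<in> hom \<sigma> A B" "h' \<in> hom \<sigma> A B" "\<And>x. x \<in> X \<Longrightarrow> h (v x) = h' (v x)"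
  shows "h = h'"
proof (rule extensionalityI)
  show "h \<in> extensional (carrier A)" "h' \<in> extensional (carrier A)"
    using h by (auto simp: hom_def PiE_def)
  fix a assume "a \<in> carrier A"
  then obtain t where t: "t \<in> terms \<sigma> X" "a = eval \<sigma> A v t"
    using gen by blast
  have "eval \<sigma> B (h \<circ> v) t = eval \<sigma> B (h' \<circ> v) t"
    using t(1) by (rule eval_cong_terms) (simp add: h(3))
  then show "h a = h' a"
    using t hom_eval[OF h(1) A v] hom_eval[OF h(2) A v] by simp
qed

section \<open>Identities of a generating algebra and a criterion for freeness\<close>

text \<open>\<open>generated_by\<close> only speaks of identities in the variables
  \<open>'i var\<close>. An injective renaming of the variables occurring in \<open>s\<close> and
  \<open>t\<close> carries the equation into that type and back without affecting
  satisfaction.\<close>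

lemma satisfies_generated_by:
  fixes A :: "('f, 'i, 'a) algebra" and B :: "('f, 'i, 'b) algebra" and s t :: "('f, 'i, 'v) trm"
  assumes E: "E \<subseteq> identities \<sigma>" and gen: "generated_by \<sigma> E A"
    and st: "s \<in> terms \<sigma> X" "t \<in> terms \<sigma> X" and sat: "satisfies \<sigma> A (s, t)"
    and B: "B \<in> variety \<sigma> E"
  shows "satisfies \<sigma> B (s, t)"
proof -
  obtain g :: "'v \<Rightarrow> 'i var" where g: "inj_on g (vars \<sigma> s \<union> vars \<sigma> t)"
    using inj_on_vars by blast
  have "terms \<sigma> Y \<subseteq> terms \<sigma> UNIV" for Y :: "'i var set"
  proof
    fix r assume "r \<in> terms \<sigma> Y" then show "r \<in> terms \<sigma> UNIV"
      by induction (auto intro: terms.intros)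
  qed
  then have "(map_trm g s, map_trm g t) \<in> identities_of \<sigma> A"
    using st map_trm_terms satisfies_rename[OF g] sat
    by (fastforce simp: identities_of_def identities_def)
  moreover have "B \<in> variety \<sigma> (identities_of \<sigma> A)"
    using B generated_by_all_types[OF E gen] by blast
  ultimately show ?thesis
    using satisfies_rename[OF g] by (auto simp: variety_def)
qed

text \<open>Reduces freeness to the absence of nontrivial relations: a relation among the
  \<open>z k\<close> is an identity of \<open>A\<close>, hence of every \<open>B\<close> in the
  variety, so sending the value of \<open>t\<close> at \<open>z\<close> to its value at
  \<open>y\<close> is well defined.\<close>

lemma free_on_generated_subalg:
  fixes A :: "('f, 'i, 'a) algebra" and z :: "'k \<Rightarrow> 'a"
  assumes E: "E \<subseteq> identities \<sigma>" and A: "A \<in> variety \<sigma> E" and gen: "generated_by \<sigma> E A"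
    and z: "z \<in> K \<rightarrow> carrier A"
    and rel: "\<And>s t. s \<in> terms \<sigma> K \<Longrightarrow> t \<in> terms \<sigma> K \<Longrightarrow>
      eval \<sigma> A z s = eval \<sigma> A z t \<Longrightarrow> satisfies \<sigma> A (s, t)"
  shows "free_on \<sigma> E (subalg A (eval \<sigma> A z ` terms \<sigma> K)) K z"
proof -
  have algA: "algebra \<sigma> A"
    using A by (simp add: variety_def)
  define S where "S = eval \<sigma> A z ` terms \<sigma> K"
  have S: "subuniverse \<sigma> A S"
    unfolding S_def by (rule subuniverse_eval[OF algA z])
  have zS: "z \<in> K \<rightarrow> S"
    unfolding S_def by (auto intro!: image_eqI[of _ _ "Var _"] terms.intros)
  have "\<exists>!h. h \<in> hom \<sigma> (subalg A S) B \<and> (\<forall>k\<in>K. h (z k) = y k)"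
    if B: "B \<in> variety \<sigma> E" and y: "y \<in> K \<rightarrow> carrier B"
    for B :: "('f, 'i, 'a + ('f, 'i, 'k) trm) algebra" and y
  proof -
    have algB: "algebra \<sigma> B"
      using B by (simp add: variety_def)
    have well: "eval \<sigma> B y s = eval \<sigma> B y t"
      if s: "s \<in> terms \<sigma> K" and t: "t \<in> terms \<sigma> K" and eq: "eval \<sigma> A z s = eval \<sigma> A z t" for s t
    proof -
      have b: "eval \<sigma> B y s \<in> carrier B"
        by (rule eval_in_carrier[OF algB y s])
      \<comment> \<open>\<open>satisfies\<close> wants an assignment of all variables, and
        \<open>y\<close> is controlled on \<open>K\<close> only. As \<open>B\<close> is not known to
        be nonempty in advance, the value of \<open>s\<close> itself serves as default.\<close>
      define w where "w k = (if k \<in> K then y k else eval \<sigma> B y s)" for k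
      have "w \<in> UNIV \<rightarrow> carrier B"
        using b y by (auto simp: w_def)
      moreover have "satisfies \<sigma> B (s, t)"
        using satisfies_generated_by[OF E gen s t rel[OF s t eq] B] .
      ultimately have "eval \<sigma> B w s = eval \<sigma> B w t"
        by (simp add: satisfies_def)
      moreover have "eval \<sigma> B w s = eval \<sigma> B y s" "eval \<sigma> B w t = eval \<sigma> B y t"
        using s t by (auto intro!: eval_cong_terms simp: w_def)
      ultimately show ?thesis
        by simp
    qed
    \<comment> \<open>An arbitrary term representing \<open>a\<close> is chosen; by
      \<open>well\<close> the choice does not matter.\<close>
    define h where "h = (\<lambda>a\<in>S. eval \<sigma> B y (inv_into (terms \<sigma> K) (eval \<sigma> A z) a))"
    have h_eval: "h (eval \<sigma> A z t) = eval \<sigma> B y t" if "t \<in> terms \<sigma> K" for t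
    proof -
      have tS: "eval \<sigma> A z t \<in> S"
        using that by (simp add: S_def)
      show ?thesis
        unfolding h_def restrict_apply'[OF tS] using that
        by (intro well) (auto simp: S_def inv_into_into f_inv_into_f)
    qed
    have hom: "h \<in> hom \<sigma> (subalg A S) B"
      unfolding hom_def mem_Collect_eq
    proof (intro conjI ballI)
      show "h \<in> carrier (subalg A S) \<rightarrow>\<^sub>E carrier B"
        by (auto simp: h_def S_def intro!: eval_in_carrier[OF algB y] inv_into_into)
      fix f a assume f: "f \<in> ops \<sigma>" and "a \<in> arity \<sigma> f \<rightarrow>\<^sub>E carrier (subalg A S)"
      then have a: "a \<in> arity \<sigma> f \<rightarrow>\<^sub>E S"
        by simp
      then have "\<forall>i\<in>arity \<sigma> f. \<exists>t. t \<in> terms \<sigma> K \<and> a i = eval \<sigma> A z t"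
        by (auto simp: S_def PiE_iff)
      then obtain ts where ts: "\<And>i. i \<in> arity \<sigma> f \<Longrightarrow> ts i \<in> terms \<sigma> K \<and> a i = eval \<sigma> A z (ts i)"
        by metis
      have "a = (\<lambda>i\<in>arity \<sigma> f. eval \<sigma> A z (ts i))"
        using a ts by (intro extensionalityI[where A = "arity \<sigma> f"]) (auto simp: PiE_iff)
      then have "oper (subalg A S) f a = eval \<sigma> A z (Op f ts)"
        by simp
      moreover have "Op f ts \<in> terms \<sigma> K"
        using f ts by (auto intro: terms.intros)
      ultimately have "h (oper (subalg A S) f a) = eval \<sigma> B y (Op f ts)"
        by (simp only: h_eval)
      also have "\<dots> = oper B f (\<lambda>i\<in>arity \<sigma> f. h (a i))"
        using ts h_eval by (auto cong: restrict_cong)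
      finally show "h (oper (subalg A S) f a) = oper B f (\<lambda>i\<in>arity \<sigma> f. h (a i))" .
    qed
    have h_gen: "h (z k) = y k" if "k \<in> K" for k
      using h_eval[of "Var k"] that by (simp add: terms.intros)
    have "g = h" if "g \<in> hom \<sigma> (subalg A S) B" "\<forall>k\<in>K. g (z k) = y k" for g
    proof (rule hom_eq_on_generated[OF algebra_subalg[OF S]])
      show "carrier (subalg A S) = eval \<sigma> (subalg A S) z ` terms \<sigma> K"
        by (simp add: S_def)
    qed (use that zS hom h_gen in auto)
    with hom h_gen show ?thesis
      by blast
  qed
  with subalg_in_variety[OF E A S] zS show ?thesis
    unfolding free_on_def S_def[symmetric] by simp
qed

theorem corollary10:
  fixes \<sigma> :: "('f, 'i) signature"
    and E :: "('f, 'i) identity set"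
    and F :: "('f, 'i, 'a) algebra"
    and m n :: nat
  assumes "E \<subseteq> identities \<sigma>"
    and "0 < m" and "m < n"
    and "free_on_generators \<sigma> E F m"
    and "\<exists>S. subuniverse \<sigma> F S \<and> free_on_generators \<sigma> E (subalg F S) n"
    and "generated_by \<sigma> E F"
  shows "\<forall>N :: nat. \<exists>S. subuniverse \<sigma> F S \<and> free_on_generators \<sigma> E (subalg F S) N"
proof
  fix N :: nat
  note E = assms(1)
  obtain x where free_x: "free_on \<sigma> E F {..<m} x"
    using assms(4) by (auto simp: free_on_generators_def)
  obtain S u where S: "subuniverse \<sigma> F S" and free_u: "free_on \<sigma> E (subalg F S) {..<n} u"
    using assms(5) by (auto simp: free_on_generators_def)
  have F: "F \<in> variety \<sigma> E" and x: "x \<in> {..<m} \<rightarrow> carrier F"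
    using free_x by (auto simp: free_on_def)
  have SV: "subalg F S \<in> variety \<sigma> E" and u: "u \<in> {..<n} \<rightarrow> S"
    using free_u by (auto simp: free_on_def)
  have algF: "algebra \<sigma> F" and algS: "algebra \<sigma> (subalg F S)"
    using F SV by (auto simp: variety_def)
  have SF: "S \<subseteq> carrier F"
    using S by (simp add: subuniverse_def)

  \<comment> \<open>The endomorphism \<theta> and homomorphisms out of \<open>S\<close>\<close>
  have "u \<in> {..<m} \<rightarrow> carrier (subalg F S)"
    using u \<open>m < n\<close> by auto
  \<comment> \<open>With \<open>subalg F S\<close> as codomain, homomorphisms defined only on
    \<open>S\<close> can be composed with \<theta>.\<close>
  from free_on_all_types[OF E free_x SV this]
  obtain \<theta> where \<theta>S: "\<theta> \<in> hom \<sigma> F (subalg F S)" and \<theta>x: "\<And>i. i < m \<Longrightarrow> \<theta> (x i) = u i"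
    by blast
  have \<theta>: "\<theta> \<in> hom \<sigma> F F"
    by (rule hom_subalg_codomain[OF S \<theta>S])
  have \<theta>_in_S: "\<theta> a \<in> S" if "a \<in> carrier F" for a
    using hom_mem[OF \<theta>S that] by simp
  have ext_u: "\<exists>g \<in> hom \<sigma> (subalg F S) F. \<forall>i<n. g (u i) = w i" if "w \<in> {..<n} \<rightarrow> carrier F" for w
    using free_on_all_types[OF E free_u F that] by blast
  \<comment> \<open>On the range of \<theta>, \<open>g\<close> is determined by its values at
    \<open>u i\<close> for \<open>i < m\<close>, since \<theta> sends the generators
    \<open>x i\<close> there.\<close>
  have on_range: "g (\<theta> a) = h a"
    if g: "g \<in> hom \<sigma> (subalg F S) F" and h: "h \<in> hom \<sigma> F F"
      and eq: "\<And>i. i < m \<Longrightarrow> g (u i) = h (x i)" and a: "a \<in> carrier F" for g h a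
  proof -
    have "compose (carrier F) g \<theta> = h"
    proof (rule hom_eq_on_generated[OF algF x free_on_generates[OF E free_x]])
      show "compose (carrier F) g \<theta> \<in> hom \<sigma> F F"
        by (rule hom_compose[OF algF \<theta>S g])
    qed (use h eq \<theta>x x in \<open>auto simp: compose_def Pi_iff\<close>)
    then show ?thesis
      using a by (auto simp: compose_def)
  qed

  have inj: "inj_on \<theta> (carrier F)"
  proof -
    \<comment> \<open>A left inverse of \<theta>. The values at the remaining \<open>u i\<close> are
      arbitrary; \<open>x 0\<close> is an available element because \<open>0 < m\<close>.\<close>
    obtain g where g: "g \<in> hom \<sigma> (subalg F S) F" "\<forall>i<n. g (u i) = x (if i < m then i else 0)"
      using ext_u[of "\<lambda>i. x (if i < m then i else 0)"] x \<open>0 < m\<close> by (auto simp: Pi_iff)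
    have "(\<lambda>a\<in>carrier F. a) \<in> hom \<sigma> F F"
      using oper_in_carrier[OF algF] unfolding hom_def
      by (auto simp: PiE_iff extensional_restrict cong: restrict_cong)
    with g have "g (\<theta> a) = a" if "a \<in> carrier F" for a
      using on_range[of g "\<lambda>a\<in>carrier F. a" a] that x \<open>m < n\<close> by (auto simp: Pi_iff)
    then show ?thesis
      by (rule inj_on_inverseI)
  qed
  \<comment> \<open>Here \<open>m < n\<close> enters: \<open>u m\<close> is a further free
    generator, so it can be sent to any \<open>c\<close> while each
    \<open>u i = \<theta> (x i)\<close> with \<open>i < m\<close> stays fixed, and with these the
    whole range of \<theta>.\<close>
  have subst: "\<exists>g \<in> hom \<sigma> (subalg F S) F. (\<forall>a\<in>carrier F. g (\<theta> a) = \<theta> a) \<and> g (u m) = c"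
    if c: "c \<in> carrier F" for c
  proof -
    have "(\<lambda>i. if i < m then u i else c) \<in> {..<n} \<rightarrow> carrier F"
      using c u SF by auto
    then obtain g where g: "g \<in> hom \<sigma> (subalg F S) F" "\<forall>i<n. g (u i) = (if i < m then u i else c)"
      using ext_u by blast
    then have "\<forall>a\<in>carrier F. g (\<theta> a) = \<theta> a"
      using on_range[OF g(1) \<theta>] \<theta>x \<open>m < n\<close> by auto
    with g \<open>m < n\<close> show ?thesis
      by (intro bexI[of _ g]) auto
  qed

  \<comment> \<open>Powers of \<theta> and independence of the orbit of \<open>u m\<close>\<close>
  have pow: "(\<theta> ^^ j) a \<in> carrier F" if "a \<in> carrier F" for j a
    using that by (induction j) (auto intro: hom_mem[OF \<theta>])
  have pow_inj: "a = b" if "(\<theta> ^^ j) a = (\<theta> ^^ j) b" "a \<in> carrier F" "b \<in> carrier F" for j a b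
    using that by (induction j) (auto dest: inj_onD[OF inj] simp: pow)
  have pow_eval: "(\<theta> ^^ j) (eval \<sigma> F v t) = eval \<sigma> F (\<lambda>i. (\<theta> ^^ j) (v i)) t"
    if v: "v \<in> X \<rightarrow> carrier F" and t: "t \<in> terms \<sigma> X" for j v t and X :: "nat set"
  proof (induction j)
    case (Suc j)
    have "(\<lambda>i. (\<theta> ^^ j) (v i)) \<in> X \<rightarrow> carrier F"
      using v pow by auto
    from hom_eval[OF \<theta> algF this t] Suc show ?case
      by (simp add: comp_def)
  qed simp

  define z where "z i = (\<theta> ^^ i) (u m)" for i
  have um: "u m \<in> S"
    using u \<open>m < n\<close> by auto
  then have z: "z i \<in> carrier F" for i
    using SF pow by (auto simp: z_def)
  have "satisfies \<sigma> F (s, t)"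
    if st: "s \<in> terms \<sigma> {..<N}" "t \<in> terms \<sigma> {..<N}" and eq: "eval \<sigma> F z s = eval \<sigma> F z t" for s t
  proof -
    \<comment> \<open>After \<open>j\<close> rounds the first \<open>j\<close> entries are replaced.
      The family \<open>c\<close> stays general because the induction hypothesis is applied to the
      family \<open>\<theta> (c i)\<close>.\<close>
    have *: "eval \<sigma> F (\<lambda>i. if i < j then (\<theta> ^^ j) (c i) else z i) s =
        eval \<sigma> F (\<lambda>i. if i < j then (\<theta> ^^ j) (c i) else z i) t"
      if "\<And>i. c i \<in> carrier F" for c j
      using that
    proof (induction j arbitrary: c)
      case 0
      then show ?case
        using eq by simp
    next
      case (Suc j)
      \<comment> \<open>The assignment of the induction hypothesis with \<open>\<theta> ^^ j\<close>
        stripped off. Its entry at \<open>j\<close> is \<open>z 0 = u m\<close>; all others are in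
        the range of \<theta>, so \<open>v\<close> takes values in \<open>S\<close>, the domain of
        \<open>g\<close> below.\<close>
      define v where "v i = (if i < j then \<theta> (c i) else z (i - j))" for i
      have vF: "v \<in> {..<N} \<rightarrow> carrier F"
        using Suc.prems z hom_mem[OF \<theta>] by (auto simp: v_def)
      have z0: "z 0 = u m" and zSuc: "z (Suc i) = \<theta> (z i)" for i
        by (simp_all add: z_def)
      have vS: "v \<in> {..<N} \<rightarrow> carrier (subalg F S)"
      proof
        fix i
        show "v i \<in> carrier (subalg F S)"
          using Suc.prems z \<theta>_in_S um by (cases "i - j") (auto simp: v_def z0 zSuc)
      qed
      have "(\<theta> ^^ j) (v i) = (if i < j then (\<theta> ^^ j) (\<theta> (c i)) else z i)" for i
        by (simp add: v_def z_def flip: funpow_add[THEN fun_cong, simplified])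
      then have "(\<theta> ^^ j) (eval \<sigma> F v s) = (\<theta> ^^ j) (eval \<sigma> F v t)"
        using Suc.IH[of "\<lambda>i. \<theta> (c i)"] hom_mem[OF \<theta> Suc.prems]
        by (simp add: pow_eval[OF vF st(1)] pow_eval[OF vF st(2)])
      then have v: "eval \<sigma> F v s = eval \<sigma> F v t"
        using pow_inj eval_in_carrier[OF algF vF] st by blast
      \<comment> \<open>Choosing \<open>\<theta> (c j)\<close> instead of \<open>c j\<close> gives
        \<open>(\<theta> ^^ Suc j) (c j)\<close> once \<open>\<theta> ^^ j\<close> is
        reapplied.\<close>
      obtain g where g: "g \<in> hom \<sigma> (subalg F S) F"
        and g\<theta>: "\<And>a. a \<in> carrier F \<Longrightarrow> g (\<theta> a) = \<theta> a" and gu: "g (u m) = \<theta> (c j)"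
        using subst[OF hom_mem[OF \<theta> Suc.prems[of j]]] by blast
      have gv: "eval \<sigma> F (g \<circ> v) s = eval \<sigma> F (g \<circ> v) t"
        using hom_eval[OF g algS vS st(1)] hom_eval[OF g algS vS st(2)] v by simp
      have gvF: "g \<circ> v \<in> {..<N} \<rightarrow> carrier F"
        using vS hom_mem[OF g] by (auto simp: Pi_iff)
      \<comment> \<open>\<open>g\<close> alters only entry \<open>j\<close>: earlier entries are
        \<open>\<theta> (c i)\<close>, later ones are \<theta> of the preceding
        \<open>z\<close>.\<close>
      have "(\<theta> ^^ j) ((g \<circ> v) i) = (if i < Suc j then (\<theta> ^^ Suc j) (c i) else z i)" for i
      proof (cases i j rule: linorder_cases)
        case less
        then show ?thesis
          using Suc.prems by (simp add: v_def g\<theta> funpow_swap1)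
      next
        case equal
        then show ?thesis
          by (simp add: v_def z0 gu funpow_swap1)
      next
        case greater
        then obtain k where k: "i = j + Suc k"
          using less_imp_Suc_add by auto
        then show ?thesis
          using z by (simp add: v_def zSuc g\<theta>) (simp add: z_def funpow_add funpow_swap1)
      qed
      then show ?case
        using arg_cong[OF gv, of "\<theta> ^^ j"]
        unfolding pow_eval[OF gvF st(1)] pow_eval[OF gvF st(2)] by presburger
    qed
    show ?thesis
      unfolding satisfies_def
    proof (intro ballI)
      fix c :: "nat \<Rightarrow> 'a" assume c: "c \<in> UNIV \<rightarrow> carrier F"
      then have cN: "c \<in> {..<N} \<rightarrow> carrier F"
        by auto
      \<comment> \<open>At \<open>j = N\<close> every variable allowed in \<open>s\<close> and
        \<open>t\<close> has been replaced, and injectivity cancels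
        \<open>\<theta> ^^ N\<close>.\<close>
      have "(\<theta> ^^ N) (eval \<sigma> F c r) = eval \<sigma> F (\<lambda>i. if i < N then (\<theta> ^^ N) (c i) else z i) r"
        if "r \<in> terms \<sigma> {..<N}" for r
        unfolding pow_eval[OF cN that] using that by (rule eval_cong_terms) simp
      then have "(\<theta> ^^ N) (eval \<sigma> F c s) = (\<theta> ^^ N) (eval \<sigma> F c t)"
        using *[of c N] c st by auto
      then show "eval \<sigma> F c (fst (s, t)) = eval \<sigma> F c (snd (s, t))"
        using pow_inj eval_in_carrier[OF algF cN] st by auto
    qed
  qed
  then have "free_on \<sigma> E (subalg F (eval \<sigma> F z ` terms \<sigma> {..<N})) {..<N} z"
    using z by (intro free_on_generated_subalg[OF E F assms(6)]) auto
  moreover have "subuniverse \<sigma> F (eval \<sigma> F z ` terms \<sigma> {..<N})"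
    using z by (intro subuniverse_eval[OF algF]) auto
  ultimately show "\<exists>S. subuniverse \<sigma> F S \<and> free_on_generators \<sigma> E (subalg F S) N"
    unfolding free_on_generators_def by blast
qed

end
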